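(* There is a continuous family $(\mathcal{S}_x)_{51\le x\le 100}$ of suspensions with hexagonal equator in $\mathbb{R}^3$, with poles $N,S$ and equator vertices $p_1,\dots,p_6$ depending continuously on $x$, such that for every $x\in[51,100]$: (i) $|N-S|^2=x$; (ii) all edge lengths $|e_j|=|N-p_j|$, $|e_j'|=|p_j-S|$, $|e_{j,j+1}|=|p_j-p_{j+1}|$ ($j=1,\dots,6$, indices modulo $6$) have the values (independent of $x$) listed in the context; (iii) for $51<x<100$, the sign of $(e_j\times e_{j+1})\cdot R$, where $e_j=N-p_j$ and $R=N-S$, equals $\varepsilon_{j,j+1}$ as listed in the context, for $j=1,\dots,6$. In particular, each $\mathcal{S}_x$ is a flexible suspension with a hexagonal equator. Moreover it is non-trivial: no $\mathcal{S}_x$ is a trivial flexible suspension of type (a) or (b) defined in the context.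
   Context: A polyhedron is a map $\mathcal{P}:K\to\mathbb{R}^3$ from a simplicial complex $K$, linear on each simplex; it is determined by the images $p_i=\mathcal{P}(v_i)$ of the vertices $v_i$ of $K$. Self-intersections are allowed. Two polyhedra $\mathcal{P},\mathcal{Q}:K\to\mathbb{R}^3$ are congruent if $\mathcal{Q}=A\circ\mathcal{P}$ for an isometry $A$ of $\mathbb{R}^3$; they are isometric if corresponding edges have equal length. $\mathcal{P}$ is flexible if there is a continuous one-parameter family $\mathcal{P}_t$, $0\le t\le1$, of polyhedra with $\mathcal{P}_0=\mathcal{P}$, each $\mathcal{P}_t$ isometric to $\mathcal{P}_0$, and some $\mathcal{P}_t$ not congruent to $\mathcal{P}_0$. A suspension with an $n$-gonal equator is a polyhedron whose complex $K$ has vertices $v_0,v_1,\dots,v_n,v_{n+1}$ and whose 2-simplices are $\langle v_0,v_j,v_{j+1}\rangle$ and $\langle v_{n+1},v_j,v_{j+1}\rangle$ for $j=1,\dots,n$ (with $v_{j+1}$ read as $v_1$ when $j=n$). Write $N=\mathcal{P}(v_0)$ (north pole), $S=\mathcal{P}(v_{n+1})$ (south pole), $p_j=\mathcal{P}(v_j)$ (equator vertices). Hexagonal means $n=6$, quadrilateral means $n=4$. Trivial flexible suspensions with hexagonal equator: (a) those obtained from a flexible suspension with quadrilateral equator by two successive insertions, where an insertion fixes an interior point of an equator edge, takes it as a new equator vertex and joins it by new edges to the north and south poles (subdividing two faces); (b) those obtained from an arbitrary suspension with hexagonal equator by removing the star of the south pole and treating the star of the north pole as a twice-covered polyhedral surface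 (so that the two poles coincide). Edge lengths: $|e_1|=\frac12\left(\frac{1436\sqrt{15}}{541}+\frac{218\sqrt{85}}{873}\right)$, $|e_1'|=\frac12\left(\frac{1436\sqrt{15}}{541}-\frac{218\sqrt{85}}{873}\right)$; $|e_2|=\frac12\left(\frac{182493018091\sqrt{170}}{62820339553}-\sqrt{30}\right)$, $|e_2'|=\frac12\left(\frac{182493018091\sqrt{170}}{62820339553}+\sqrt{30}\right)$; $|e_3|=\frac12\left(\frac{31054297\sqrt{102}}{22844303}-\sqrt2\right)$, $|e_3'|=\frac12\left(\frac{31054297\sqrt{102}}{22844303}+\sqrt2\right)$; $|e_4|=\frac12\left(4\sqrt{15}-\frac{218\sqrt{85}}{873}\right)$, $|e_4'|=\frac12\left(4\sqrt{15}+\frac{218\sqrt{85}}{873}\right)$; $|e_5|=\frac12\left(\frac{17\sqrt{170}}{11}-\sqrt{30}\right)$, $|e_5'|=\frac12\left(\frac{17\sqrt{170}}{11}+\sqrt{30}\right)$; $|e_6|=\frac12\left(\sqrt{102}+\sqrt2\right)$, $|e_6'|=\frac12\left(\sqrt{102}-\sqrt2\right)$; $|e_{12}|=\frac{541419683182996345}{29669606628505029}$, $|e_{23}|=\frac{31635727886833754300}{1435086871311616559}$, $|e_{34}|=\frac{27288800741}{19943076519}$, $|e_{45}|=\frac{130585}{9603}$, $|e_{56}|=\frac{100}{11}$, $|e_{61}|=\frac{310327}{472293}$. Signs: $\varepsilon_{12}=-1$, $\varepsilon_{23}=+1$, $\varepsilon_{34}=+1$, $\varepsilon_{45}=-1$,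 $\varepsilon_{56}=+1$, $\varepsilon_{61}=-1$. *)

theory Defs
  imports "HOL-Analysis.Analysis"
begin

section \<open>Polyhedra\<close>

text \<open>
  A polyhedron is a map from a simplicial complex \<open>K\<close> to \<open>real^3\<close> that is linear on each simplex.
  Such a map is determined by the images of the vertices, and is represented by the abstract complex
  \<open>K\<close> (its set of nonempty simplices) together with the vertex map \<open>p :: nat \<Rightarrow> real^3\<close>;
  the values of \<open>p\<close> outside \<open>\<Union>K\<close> are irrelevant. No injectivity or nondegeneracy is required.
\<close>

definition simplicial_complex :: "nat set set \<Rightarrow> bool" where
  "simplicial_complex K \<longleftrightarrow>
     finite K \<and> (\<forall>s\<in>K. finite s \<and> s \<noteq> {} \<and> (\<forall>t. t \<subseteq> s \<and> t \<noteq> {} \<longrightarrow> t \<in> K))"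

text \<open>
  Isometries of \<open>real^3\<close> are affine, so \<open>q = A \<circ> p\<close> on all of \<open>|K|\<close> iff this holds at the vertices.
\<close>

definition congruent_polyhedra ::
    "nat set set \<Rightarrow> (nat \<Rightarrow> real^3) \<Rightarrow> (nat \<Rightarrow> real^3) \<Rightarrow> bool" where
  "congruent_polyhedra K p q \<longleftrightarrow>
     (\<exists>A :: real^3 \<Rightarrow> real^3. (\<forall>a b. dist (A a) (A b) = dist a b) \<and> (\<forall>v\<in>\<Union>K. q v = A (p v)))"

definition isometric_polyhedra ::
    "nat set set \<Rightarrow> (nat \<Rightarrow> real^3) \<Rightarrow> (nat \<Rightarrow> real^3) \<Rightarrow> bool" where
  "isometric_polyhedra K p q \<longleftrightarrow>
     (\<forall>u v. {u, v} \<in> K \<longrightarrow> dist (q u) (q v) = dist (p u) (p v))"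

definition flexible :: "nat set set \<Rightarrow> (nat \<Rightarrow> real^3) \<Rightarrow> bool" where
  "flexible K p \<longleftrightarrow>
     (\<exists>P :: real \<Rightarrow> nat \<Rightarrow> real^3.
        (\<forall>v\<in>\<Union>K. continuous_on {0..1} (\<lambda>t. P t v)) \<and>
        (\<forall>v\<in>\<Union>K. P 0 v = p v) \<and>
        (\<forall>t\<in>{0..1}. isometric_polyhedra K (P 0) (P t)) \<and>
        (\<exists>t\<in>{0..1}. \<not> congruent_polyhedra K (P 0) (P t)))"

section \<open>Suspensions\<close>

text \<open>
  Vertex \<open>0\<close> is the north pole, \<open>n + 1\<close> the south pole, and \<open>1, \<dots>, n\<close> is the equator.
\<close>

definition eq_next :: "nat \<Rightarrow> nat \<Rightarrow> nat" where
  "eq_next n j = (if j = n then 1 else j + 1)"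

definition suspension_complex :: "nat \<Rightarrow> nat set set" where
  "suspension_complex n =
     {s. s \<noteq> {} \<and> (\<exists>j\<in>{1..n}. s \<subseteq> {0, j, eq_next n j} \<or> s \<subseteq> {n + 1, j, eq_next n j})}"

lemma simplicial_complex_suspension_complex: "simplicial_complex (suspension_complex n)"
proof -
  have eq: "suspension_complex n =
      (\<Union>j\<in>{1..n}. Pow {0, j, eq_next n j} \<union> Pow {n + 1, j, eq_next n j}) - {{}}"
    unfolding suspension_complex_def by blast
  have "finite (suspension_complex n)"
    unfolding eq by (intro finite_Diff finite_UN_I) simp_all
  moreover have "finite s" if "s \<in> suspension_complex n" for s
  proof -
    from that obtain i j where "s \<subseteq> {i, j, eq_next n j}"
      unfolding suspension_complex_def by blast
    then show ?thesis by (rule finite_subset) simp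
  qed
  moreover have "s \<noteq> {}" if "s \<in> suspension_complex n" for s
    using that unfolding suspension_complex_def by simp
  moreover have "t \<in> suspension_complex n"
    if st: "s \<in> suspension_complex n" "t \<subseteq> s" "t \<noteq> {}" for s t
  proof -
    from st(1) obtain i j where ij: "i = 0 \<or> i = n + 1" "j \<in> {1..n}" "s \<subseteq> {i, j, eq_next n j}"
      unfolding suspension_complex_def by blast
    have "t \<subseteq> {i, j, eq_next n j}"
      by (rule subset_trans[OF st(2) ij(3)])
    then have "t \<subseteq> {0, j, eq_next n j} \<or> t \<subseteq> {n + 1, j, eq_next n j}"
      using ij(1) by (elim disjE) simp_all
    then have "\<exists>j\<in>{1..n}. t \<subseteq> {0, j, eq_next n j} \<or> t \<subseteq> {n + 1, j, eq_next n j}"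
      using ij(2) by (rule bexI)
    with st(3) show ?thesis
      unfolding suspension_complex_def by simp
  qed
  ultimately show ?thesis
    unfolding simplicial_complex_def by simp
qed

lemma vertices_suspension_complex:
  assumes "n \<ge> 1"
  shows "\<Union>(suspension_complex n) = {0..n + 1}"
proof
  have "s \<subseteq> {0..n + 1}" if "s \<in> suspension_complex n" for s
  proof -
    from that obtain i j where "i \<le> n + 1" "j \<in> {1..n}" "s \<subseteq> {i, j, eq_next n j}"
      unfolding suspension_complex_def by blast
    moreover have "{i, j, eq_next n j} \<subseteq> {0..n + 1}" if "i \<le> n + 1" "j \<in> {1..n}" for i j
      using that by (simp add: eq_next_def)
    ultimately show ?thesis by (meson subset_trans)
  qed
  then show "\<Union>(suspension_complex n) \<subseteq> {0..n + 1}" by (rule Union_least)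
  have "{v} \<in> suspension_complex n" if v: "v \<le> n + 1" for v
  proof (cases "v \<in> {1..n}")
    case True
    then show ?thesis unfolding suspension_complex_def by blast
  next
    case False
    with v have "v = 0 \<or> v = n + 1" by simp linarith
    moreover have "(1::nat) \<in> {1..n}" using assms by simp
    ultimately show ?thesis unfolding suspension_complex_def by blast
  qed
  then show "{0..n + 1} \<subseteq> \<Union>(suspension_complex n)"
    by (metis Union_iff atLeastAtMost_iff singletonI subsetI)
qed

text \<open>
  \<open>r\<close> (with an \<open>(n+1)\<close>-gonal equator) arises from \<open>q\<close> (with an \<open>n\<close>-gonal equator) by inserting a
  point interior to an equator edge as a new equator vertex, which gets the label \<open>k\<close>; the labels
  of the later vertices are shifted by one. Since \<open>k = 1\<close> and \<open>k = n + 1\<close> (both insertions into the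
  edge between \<open>q n\<close> and \<open>q 1\<close>) are both allowed, iterated insertions reach every labelling of
  the resulting suspension, up to relabelling the one started from.
\<close>

definition equator_insertion :: "nat \<Rightarrow> (nat \<Rightarrow> real^3) \<Rightarrow> (nat \<Rightarrow> real^3) \<Rightarrow> bool" where
  "equator_insertion n q r \<longleftrightarrow>
     r 0 = q 0 \<and> r (n + 2) = q (n + 1) \<and>
     (\<exists>k\<in>{1..n + 1}.
        (\<forall>j\<in>{1..<k}. r j = q j) \<and> (\<forall>j\<in>{k..n}. r (j + 1) = q j) \<and>
        (\<exists>t::real. 0 < t \<and> t < 1 \<and>
           r k = (1 - t) *\<^sub>R q (if k = 1 then n else k - 1) + t *\<^sub>R q (if k = n + 1 then 1 else k)))"

definition trivial_by_insertion :: "(nat \<Rightarrow> real^3) \<Rightarrow> bool" where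
  "trivial_by_insertion p \<longleftrightarrow>
     (\<exists>q r. flexible (suspension_complex 4) q \<and> equator_insertion 4 q r \<and> equator_insertion 5 r p)"

text \<open>
  Here \<open>q\<close> is the arbitrary hexagonal suspension; the star of its south pole is replaced
  by a second copy of the star of its north pole.
\<close>

definition trivial_by_doubling :: "(nat \<Rightarrow> real^3) \<Rightarrow> bool" where
  "trivial_by_doubling p \<longleftrightarrow>
     (\<exists>q :: nat \<Rightarrow> real^3. (\<forall>v\<in>{0..6}. p v = q v) \<and> p 7 = q 0)"

section \<open>The numerical data\<close>

text \<open>
  Argument \<open>j\<close> ranges over \<open>{1..6}\<close>: \<open>len_north j\<close>, \<open>len_south j\<close> and \<open>len_equator j\<close> are the lengths
  of \<open>e\<^sub>j\<close>, \<open>e'\<^sub>j\<close> and of the equator edge from vertex \<open>j\<close> to its cyclic successor.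
\<close>

definition len_north :: "nat \<Rightarrow> real" where
  "len_north j =
     [1/2 * (1436 * sqrt 15 / 541 + 218 * sqrt 85 / 873),
      1/2 * (182493018091 * sqrt 170 / 62820339553 - sqrt 30),
      1/2 * (31054297 * sqrt 102 / 22844303 - sqrt 2),
      1/2 * (4 * sqrt 15 - 218 * sqrt 85 / 873),
      1/2 * (17 * sqrt 170 / 11 - sqrt 30),
      1/2 * (sqrt 102 + sqrt 2)] ! (j - 1)"

definition len_south :: "nat \<Rightarrow> real" where
  "len_south j =
     [1/2 * (1436 * sqrt 15 / 541 - 218 * sqrt 85 / 873),
      1/2 * (182493018091 * sqrt 170 / 62820339553 + sqrt 30),
      1/2 * (31054297 * sqrt 102 / 22844303 + sqrt 2),
      1/2 * (4 * sqrt 15 + 218 * sqrt 85 / 873),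
      1/2 * (17 * sqrt 170 / 11 + sqrt 30),
      1/2 * (sqrt 102 - sqrt 2)] ! (j - 1)"

definition len_equator :: "nat \<Rightarrow> real" where
  "len_equator j =
     [541419683182996345 / 29669606628505029,
      31635727886833754300 / 1435086871311616559,
      27288800741 / 19943076519,
      130585 / 9603,
      100 / 11,
      310327 / 472293] ! (j - 1)"

definition face_sign :: "nat \<Rightarrow> real" where
  "face_sign j = [-1, 1, 1, -1, 1, -1] ! (j - 1)"

end

theory Submission
  imports Defs
begin

text \<open>
  Put the poles on a vertical axis at distance \<open>sqrt x\<close>. The lengths \<open>|e\<^sub>j|\<close> and \<open>|e'\<^sub>j|\<close> determine
  the height of \<open>p\<^sub>j\<close> and the modulus of its horizontal part \<open>w\<^sub>j\<close>, a complex number, and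
  \<open>|e\<^bsub>j,j+1\<^esub>|\<close> determines the real part of \<open>cnj w\<^sub>j * w\<^sub>j\<^sub>+\<^sub>1\<close>. With the given data the imaginary part is
  a rational multiple of \<open>sqrt ((x - 51) * (100 - x) / x)\<close> for every \<open>j\<close>, its sign being
  \<open>\<epsilon>\<^bsub>j,j+1\<^esub>\<close>. The equator therefore closes up iff a product of six elements of
  \<open>\<rat>(x, sqrt (- x * (x - 51) * (100 - x)))\<close> is 1. Up to real factors, the product of the first
  three is conjugate to the product of the last three.

  A vertex inserted into an equator edge is an affine combination of its neighbours, and so is the
  value of \<open>|N - p|\<^sup>2 - |p - S|\<^sup>2\<close> there, which the edge lengths refute at every vertex.
\<close>

section \<open>The edge length data in rational terms\<close>

definition len_sum :: "nat \<Rightarrow> real" where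
  "len_sum j = len_north j + len_south j"

definition len_diff :: "nat \<Rightarrow> real" where
  "len_diff j = len_north j - len_south j"

definition sum_sq :: "nat \<Rightarrow> real" where
  "sum_sq j = [30931440/292681, 170 * (182493018091/62820339553)\<^sup>2, 102 * (31054297/22844303)\<^sup>2,
     240, 49130/121, 102] ! (j - 1)"

definition diff_sq :: "nat \<Rightarrow> real" where
  "diff_sq j = [4039540/762129, 30, 2, 4039540/762129, 30, 2] ! (j - 1)"

text \<open>Each difference |e_j|^2 - |e_j'|^2 = \<open>len_sum j * len_diff j\<close> is a rational
  multiple of \<open>sqrt 51\<close>. Keeping only the rational factor gives the polynomial
  identities in x below rational coefficients.\<close>

definition sq_diff_coeff :: "nat \<Rightarrow> real" where
  "sq_diff_coeff j = [1565240/472293, - (1824930180910/62820339553), - (62108594/22844303),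
     - (4360/873), - (170/11), 2] ! (j - 1)"

lemma vertex_cases:
  assumes "j \<in> {1..6::nat}"
  obtains "j = 1" | "j = 2" | "j = 3" | "j = 4" | "j = 5" | "j = 6"
proof -
  from assms have "j = 1 \<or> j = 2 \<or> j = 3 \<or> j = 4 \<or> j = 5 \<or> j = 6" by auto
  with that show thesis by blast
qed

lemmas data_defs = len_north_def len_south_def len_equator_def face_sign_def
  sum_sq_def diff_sq_def sq_diff_coeff_def

lemma len_sum_sq:
  assumes "j \<in> {1..6}"
  shows "(len_sum j)\<^sup>2 = sum_sq j"
  using assms
  by (rule vertex_cases) (simp_all add: len_sum_def data_defs power_mult_distrib power_divide flip: add_divide_distrib)

lemma len_diff_sq:
  assumes "j \<in> {1..6}"
  shows "(len_diff j)\<^sup>2 = diff_sq j"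
  using assms
  by (rule vertex_cases) (simp_all add: len_diff_def data_defs power_mult_distrib power_divide flip: diff_divide_distrib)

lemma len_sum_diff:
  assumes "j \<in> {1..6}"
  shows "len_sum j * len_diff j = sq_diff_coeff j * sqrt 51"
proof -
  \<comment> \<open>The data pair sqrt 15 with sqrt 85, sqrt 170 with sqrt 30, and sqrt 102 with
    sqrt 2; these are the three products.\<close>
  have "sqrt 1275 = 5 * sqrt 51" "sqrt 5100 = 10 * sqrt 51" "sqrt 204 = 2 * sqrt 51"
    by (rule real_sqrt_unique; simp add: power_mult_distrib)+
  then show ?thesis
    using assms 
    by - (erule vertex_cases; simp add: len_sum_def len_diff_def data_defs field_simps flip: real_sqrt_mult)
qed

lemma len_sum_pos: "j \<in> {1..6} \<Longrightarrow> len_sum j > 0"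
  by (erule vertex_cases) (simp_all add: len_sum_def data_defs flip: add_divide_distrib)

text \<open>Together with \<open>diff_sq_lt\<close> this is the strict triangle inequality for N,
  p_j, S on the whole parameter interval, so no p_j ever meets the axis.\<close>

lemma sum_sq_gt: "j \<in> {1..6} \<Longrightarrow> sum_sq j > 100"
  by (erule vertex_cases) (simp_all add: data_defs power2_eq_square)

lemma diff_sq_lt: "j \<in> {1..6} \<Longrightarrow> diff_sq j < 51"
  by (erule vertex_cases) (simp_all add: data_defs)

section \<open>Gram determinants and the turning of the equator\<close>

definition rot_coeff :: "nat \<Rightarrow> real" where
  "rot_coeff j = (sum_sq j + diff_sq j + sum_sq (eq_next 6 j) + diff_sq (eq_next 6 j)) / 2 - 2 * (len_equator j)\<^sup>2"

text \<open>The special feature of the data: for every j the Gram determinant of e_j, e_{j+1}, R is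
  |e_{j,j+1}|^2 * (x - 51) * (100 - x) / 4, with the same two roots. The constants are 604 = 4 * (51
  + 100) and 400 = 4 * 51 * 100 / 51.\<close>

lemma gram_coefficients:
  assumes "j \<in> {1..6}"
  shows "(sum_sq j + diff_sq j) * (sum_sq (eq_next 6 j) + diff_sq (eq_next 6 j))
     + 51 * (sq_diff_coeff j - sq_diff_coeff (eq_next 6 j))\<^sup>2 - (rot_coeff j)\<^sup>2 = 604 * (len_equator j)\<^sup>2" (is ?A)
  and "(sum_sq j + diff_sq j) * (sq_diff_coeff (eq_next 6 j))\<^sup>2 
     + (sum_sq (eq_next 6 j) + diff_sq (eq_next 6 j)) * (sq_diff_coeff j)\<^sup>2
     - 2 * rot_coeff j * sq_diff_coeff j * sq_diff_coeff (eq_next 6 j) = 400 * (len_equator j)\<^sup>2" (is ?B)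
proof -
  show ?A using assms
    by (rule vertex_cases) (simp_all add: rot_coeff_def data_defs eq_next_def power2_eq_square)
  show ?B using assms
    by (rule vertex_cases) (simp_all add: rot_coeff_def data_defs eq_next_def power2_eq_square)
qed


lemma eq_next_in: "j \<in> {1..6} \<Longrightarrow> eq_next 6 j \<in> {1..6}"
  by (auto simp: eq_next_def)

lemma sum_diff_sq:
  assumes "j \<in> {1..6}"
  shows "sum_sq j * diff_sq j = 51 * (sq_diff_coeff j)\<^sup>2"
  using arg_cong[OF len_sum_diff[OF assms], of "\<lambda>t. t\<^sup>2"]
  by (simp add: power_mult_distrib len_sum_sq[OF assms] len_diff_sq[OF assms])

definition radial :: "nat \<Rightarrow> real \<Rightarrow> real" where
  "radial j x = (sum_sq j - x) * (x - diff_sq j)"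

definition sqrt_gram :: "real \<Rightarrow> real" where
  "sqrt_gram x = sqrt (x * (x - 51) * (100 - x))"

text \<open>
  \<open>rot j x\<close> is \<open>4 * x * cnj w\<^sub>j * w\<^sub>j\<^sub>+\<^sub>1\<close>, and \<open>radial j x\<close> is \<open>4 * x * |w\<^sub>j|\<^sup>2\<close>.
\<close>

definition rot :: "nat \<Rightarrow> real \<Rightarrow> complex" where
  "rot j x = Complex (rot_coeff j * x - x\<^sup>2 - 51 * sq_diff_coeff j * sq_diff_coeff (eq_next 6 j))
     (2 * face_sign j * len_equator j * sqrt_gram x)"

text \<open>The rotation about the axis is fixed by taking \<open>w_1\<close> real and positive;
  each further factor carries \<open>w_i\<close> to \<open>w_{i+1}\<close>. The edge from p_6 back
  to p_1 does not enter, which leaves the closing condition to be proved.\<close>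

definition planar :: "nat \<Rightarrow> real \<Rightarrow> complex" where
  "planar j x = of_real (sqrt (radial 1 x / (4 * x))) * (\<Prod>i\<in>{1..<j}. rot i x / of_real (radial i x))"

lemma radial_pos: "\<lbrakk>j \<in> {1..6}; x \<in> {51..100}\<rbrakk> \<Longrightarrow> radial j x > 0"
  using sum_sq_gt[of j] diff_sq_lt[of j] by (auto simp: radial_def)

lemma radial_eq:
  "j \<in> {1..6} \<Longrightarrow> radial j x = (sum_sq j + diff_sq j) * x - x\<^sup>2 - 51 * (sq_diff_coeff j)\<^sup>2"
  using sum_diff_sq[of j] by (simp add: radial_def algebra_simps power2_eq_square)

lemma sqrt_gram_sq: "x \<in> {51..100} \<Longrightarrow> (sqrt_gram x)\<^sup>2 = x * (x - 51) * (100 - x)"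
  by (simp add: sqrt_gram_def)

lemma face_sign_sq: "j \<in> {1..6} \<Longrightarrow> (face_sign j)\<^sup>2 = 1"
  by (erule vertex_cases) (simp_all add: data_defs)

text \<open>
  The 4th and 0th powers of \<open>x\<close> cancel automatically, the cubic one by the choice of \<open>b\<close>; the two
  hypotheses on coefficients compare the remaining ones.
\<close>

lemma gram_identity:
  fixes s s' c c' b l x :: real
  assumes "b = (s + s') / 2 - 2 * l\<^sup>2"
    and "s * s' + 51 * (c - c')\<^sup>2 - b\<^sup>2 = 604 * l\<^sup>2"
    and "s * c'\<^sup>2 + s' * c\<^sup>2 - 2 * b * c * c' = 400 * l\<^sup>2"
  shows "(s * x - x\<^sup>2 - 51 * c\<^sup>2) * (s' * x - x\<^sup>2 - 51 * c'\<^sup>2)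
    = (b * x - x\<^sup>2 - 51 * c * c')\<^sup>2 + 4 * l\<^sup>2 * (x * (x - 51) * (100 - x))"
proof -
  have s': "s' = 2 * b + 4 * l\<^sup>2 - s" using assms(1) by (simp add: field_simps)
  show ?thesis using assms(2,3) unfolding s' by algebra
qed

text \<open>The real part of \<open>rot\<close> comes from the law of cosines, the imaginary part
  from the Gram determinant; \<open>gram_identity\<close> makes them compatible, so that
  multiplication by \<open>rot j x / radial j x\<close> produces the right modulus for the next
  vertex.\<close>

lemma cmod_rot:
  assumes "j \<in> {1..6}" "x \<in> {51..100}"
  shows "(cmod (rot j x))\<^sup>2 = radial j x * radial (eq_next 6 j) x"
proof -
  note g = gram_identity[OF _ gram_coefficients[OF assms(1)], of x]
  show ?thesis
    unfolding cmod_power2 rot_def radial_eq[OF assms(1)] radial_eq[OF eq_next_in[OF assms(1)]]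
    by (subst g) (simp_all add: rot_coeff_def power_mult_distrib sqrt_gram_sq[OF assms(2)] face_sign_sq[OF assms(1)])
qed

section \<open>The closing condition\<close>

lemma Complex_mult_sqrt_gram:
  assumes "x \<in> {51..100}"
  shows "Complex a (b * sqrt_gram x) * Complex c (d * sqrt_gram x)
    = Complex (a * c - b * d * (x * (x - 51) * (100 - x))) ((a * d + b * c) * sqrt_gram x)"
  unfolding sqrt_gram_sq[OF assms, symmetric] by (simp add: complex_eq_iff algebra_simps power2_eq_square)

text \<open>With Y = i * \<open>sqrt_gram x\<close>, so Y^2 = x * (x - 51) * (x - 100), this is a
  function a(x) + b(x) * Y on an elliptic curve: what the product of the last three
  \<open>rot\<close> leaves after its real linear factors are removed.\<close>

definition half_rot :: "real \<Rightarrow> complex" where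
  "half_rot x = Complex (x^3 - 81960/541 * x\<^sup>2 + 3781140/541 * x + 5169600/541)
     ((5588/541 * x + 115440/541) * sqrt_gram x)"

lemma rot_123:
  assumes "x \<in> {51..100}"
  shows "rot 1 x * rot 2 x * rot 3 x =
    of_real ((x - sum_sq 2) * (sum_sq 3 - x) * (x - diff_sq 1)) * cnj (half_rot x)"
proof -
  \<comment> \<open>The quotient of \<open>rot 1 x * rot 2 x\<close> by \<open>x - sum_sq 2\<close>,
    a factor that divides the squared moduli of both through \<open>radial 2 x\<close>.\<close>
  define q where
    "q = Complex (x^3 - 1639038808843078/10789204396779 * x\<^sup>2
         + 23613492850855480/3596401465593 * x + 16526525464335200/1198800488531)
       ((- (81915429186410/10789204396779) * x - 303735170706820/1198800488531) * sqrt_gram x)"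
  have "rot 1 x * rot 2 x = of_real (x - sum_sq 2) * q"
    unfolding rot_def q_def Complex_mult_sqrt_gram[OF assms]
    by (simp add: complex_eq_iff rot_coeff_def data_defs eq_next_def)
       (auto simp: field_simps power2_eq_square power3_eq_cube)
  moreover have "q * rot 3 x = of_real ((sum_sq 3 - x) * (x - diff_sq 1)) * cnj (half_rot x)"
    unfolding rot_def q_def half_rot_def Complex_mult_sqrt_gram[OF assms]
    by (simp add: complex_eq_iff rot_coeff_def data_defs eq_next_def)
       (auto simp: field_simps power2_eq_square power3_eq_cube)
  ultimately show ?thesis by (simp only: of_real_mult mult.assoc)
qed

lemma rot_456:
  assumes "x \<in> {51..100}"
  shows "rot 4 x * rot 5 x * rot 6 x =
    of_real ((x - sum_sq 5) * (sum_sq 6 - x) * (x - diff_sq 4)) * half_rot x"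
proof -
  define q where
    "q = Complex (x^3 - 143186/873 * x\<^sup>2 + 2146760/291 * x + 1482400/97)
       ((7870/873 * x + 27340/97) * sqrt_gram x)"
  have "rot 4 x * rot 5 x = of_real (x - sum_sq 5) * q"
    unfolding rot_def q_def Complex_mult_sqrt_gram[OF assms]
    by (simp add: complex_eq_iff rot_coeff_def data_defs eq_next_def)
       (auto simp: field_simps power2_eq_square power3_eq_cube)
  moreover have "q * rot 6 x = of_real ((sum_sq 6 - x) * (x - diff_sq 4)) * half_rot x"
    unfolding rot_def q_def half_rot_def Complex_mult_sqrt_gram[OF assms]
    by (simp add: complex_eq_iff rot_coeff_def data_defs eq_next_def)
       (auto simp: field_simps power2_eq_square power3_eq_cube)
  ultimately show ?thesis by (simp only: of_real_mult mult.assoc)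
qed

text \<open>Together with the linear factors in \<open>rot_123\<close> and \<open>rot_456\<close>,
  each root \<open>sum_sq i\<close> and \<open>diff_sq i\<close> of the six \<open>radial\<close>
  polynomials occurs exactly once; the reversed signs of \<open>x - sum_sq 2\<close> and
  \<open>x - sum_sq 5\<close> cancel. The data satisfy \<open>diff_sq 2 = diff_sq 5\<close> and
  \<open>diff_sq 3 = diff_sq 6\<close>.\<close>

lemma cmod_half_rot:
  assumes "x \<in> {51..100}"
  shows "(cmod (half_rot x))\<^sup>2 = (sum_sq 1 - x) * (sum_sq 4 - x) *
    ((x - diff_sq 2) * (x - diff_sq 3) * (x - diff_sq 5) * (x - diff_sq 6))"
  unfolding cmod_power2 half_rot_def complex.sel power_mult_distrib sqrt_gram_sq[OF assms]
  by (simp add: data_defs)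
     (simp add: field_simps power2_eq_square power3_eq_cube)

lemma prod_rot:
  assumes "x \<in> {51..100}"
  shows "(\<Prod>i\<in>{1..6}. rot i x / of_real (radial i x)) = 1"
proof -
  have six: "{1..6::nat} = {1, 2, 3, 4, 5, 6}" by auto
  have "(\<Prod>i\<in>{1..6}. rot i x) = rot 1 x * rot 2 x * rot 3 x * (rot 4 x * rot 5 x * rot 6 x)"
    unfolding six by simp
  also have "\<dots> = of_real ((x - sum_sq 2) * (sum_sq 3 - x) * (x - diff_sq 1)
      * ((x - sum_sq 5) * (sum_sq 6 - x) * (x - diff_sq 4)) * (cmod (half_rot x))\<^sup>2)"
    unfolding rot_123[OF assms] rot_456[OF assms] of_real_mult complex_norm_square
    by (simp only: ac_simps)
  also have "\<dots> = of_real (\<Prod>i\<in>{1..6}. radial i x)"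
    unfolding cmod_half_rot[OF assms] six of_real_eq_iff
    by (simp add: radial_def) (simp add: algebra_simps)
  finally have "(\<Prod>i\<in>{1..6}. rot i x) = of_real (\<Prod>i\<in>{1..6}. radial i x)" .
  moreover have "\<forall>i\<in>{1..6}. radial i x \<noteq> 0"
    using radial_pos[OF _ assms] by (metis less_irrefl)
  ultimately show ?thesis
    by (simp add: prod_dividef)
qed

section \<open>Horizontal parts and heights of the equator vertices\<close>

lemma planar_next:
  assumes "j \<in> {1..6}" "x \<in> {51..100}"
  shows "planar (eq_next 6 j) x = planar j x * (rot j x / of_real (radial j x))"
proof (cases "j = 6")
  case True
  \<comment> \<open>The wrap-around from p_6 to p_1 is the one step that needs the closing
    condition.\<close>
  have "{1..6} = insert 6 {1..<6::nat}" by auto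
  with prod_rot[OF assms(2)] have "(\<Prod>i\<in>{1..<6}. rot i x / of_real (radial i x)) * (rot 6 x / of_real (radial 6 x)) = 1"
    by (simp add: mult.commute)
  then show ?thesis
    unfolding True planar_def mult.assoc by (simp add: eq_next_def)
next
  case False
  have "eq_next 6 j = Suc j" using False by (simp add: eq_next_def)
  then show ?thesis using assms(1) by (simp add: planar_def)
qed

lemma cmod_planar:
  assumes "j \<in> {1..6}" "x \<in> {51..100}"
  shows "(cmod (planar j x))\<^sup>2 = radial j x / (4 * x)"
proof -
  have "j \<ge> 1" using assms(1) by simp
  then have "j \<le> 6 \<Longrightarrow> ?thesis"
  proof (induction j rule: nat_induct_at_least)
    case base
    show ?case using radial_pos[of 1 x] assms(2) by (simp add: planar_def norm_mult)
  next
    case (Suc j)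
    then have j: "j \<in> {1..6}" "eq_next 6 j = Suc j" by (auto simp: eq_next_def)
    have "(cmod (planar (Suc j) x))\<^sup>2 = (cmod (planar j x))\<^sup>2 * (cmod (rot j x))\<^sup>2 / (radial j x)\<^sup>2"
      using planar_next[OF j(1) assms(2)]
      by (simp add: j(2) norm_mult norm_divide power_mult_distrib power_divide)
    also have "\<dots> = radial (Suc j) x / (4 * x)"
      using Suc radial_pos[OF j(1) assms(2)] cmod_rot[OF j(1) assms(2)]
      by (simp add: j(2) power2_eq_square)
    finally show ?case .
  qed
  with assms(1) show ?thesis by simp
qed

lemma cnj_planar_next:
  assumes "j \<in> {1..6}" "x \<in> {51..100}"
  shows "cnj (planar j x) * planar (eq_next 6 j) x = rot j x / of_real (4 * x)"
proof -
  have "cnj (planar j x) * planar (eq_next 6 j) x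
    = of_real ((cmod (planar j x))\<^sup>2) * (rot j x / of_real (radial j x))"
    unfolding planar_next[OF assms] complex_norm_square by (simp add: mult_ac)
  also have "\<dots> = rot j x / of_real (4 * x)"
    unfolding cmod_planar[OF assms] using radial_pos[OF assms] by simp
  finally show ?thesis .
qed

text \<open>With S at height 0 and N at height \<open>sqrt x\<close>, a point at height z has |N -
  p|^2 - |p - S|^2 = x - 2 * sqrt x * z; solve for z.\<close>

definition axial :: "nat \<Rightarrow> real \<Rightarrow> real" where
  "axial j x = (x - len_sum j * len_diff j) / (2 * sqrt x)"

section \<open>The suspension in space, its edges and face signs\<close>

definition point :: "complex \<Rightarrow> real \<Rightarrow> real^3" where
  "point w z = vector [Re w, Im w, z]"

definition susp :: "real \<Rightarrow> nat \<Rightarrow> real^3" where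
  "susp x v = (if v = 0 then point 0 (sqrt x) else if v = 7 then point 0 0
     else point (planar v x) (axial v x))"

lemma norm_point_diff: "(norm (point w z - point w' z'))\<^sup>2 = (cmod (w - w'))\<^sup>2 + (z - z')\<^sup>2"
  by (simp add: point_def norm_vec_def L2_set_def sum_3 sum_nonneg cmod_power2)

text \<open>R is vertical, so only the horizontal parts -w and -w' enter the triple product.\<close>

lemma cross3_point:
  "cross3 (point 0 t - point w z) (point 0 t - point w' z') \<bullet> (point 0 t - point 0 0)
    = t * Im (cnj w * w')"
  by (simp add: point_def cross3_def inner_vec_def sum_3 algebra_simps)

lemma continuous_on_point:
  assumes "continuous_on A f" "continuous_on A g"
  shows "continuous_on A (\<lambda>x. point (f x) (g x))"
proof -
  have "(\<lambda>x. point (f x) (g x)) = (\<lambda>x. \<chi> i. if i = 1 then Re (f x) else if i = 2 then Im (f x) else g x)"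
    by (auto simp: point_def vec_eq_iff forall_3)
  moreover have "continuous_on A (\<lambda>x. if i = 1 then Re (f x) else if i = 2 then Im (f x) else g x)" for i :: 3
    using exhaust_3[of i] assms by (auto intro!: continuous_intros)
  ultimately show ?thesis by (simp only: continuous_on_vec_lambda)
qed

lemma susp_simps:
  "susp x 0 = point 0 (sqrt x)" "susp x 7 = point 0 0"
  "j \<in> {1..6} \<Longrightarrow> susp x j = point (planar j x) (axial j x)"
  by (auto simp: susp_def)

lemma continuous_on_planar:
  assumes "j \<in> {1..6}"
  shows "continuous_on {51..100} (planar j)"
proof -
  have r: "continuous_on A (radial i)" for A i
    unfolding radial_def by (intro continuous_intros)
  have u: "continuous_on A (rot i)" for A i
    unfolding rot_def sqrt_gram_def Complex_eq by (intro continuous_intros)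
  show ?thesis
    unfolding planar_def using radial_pos assms
    by (intro continuous_intros r u) (fastforce simp: less_imp_neq[THEN not_sym])+
qed

lemma continuous_on_susp:
  assumes "v \<in> {0..7}"
  shows "continuous_on {51..100} (\<lambda>x. susp x v)"
proof -
  consider "v = 0" | "v = 7" | "v \<in> {1..6}" using assms by fastforce
  then show ?thesis
  proof cases
    case 3
    then show ?thesis unfolding susp_simps(3)[OF 3] axial_def
      by (intro continuous_on_point continuous_on_planar continuous_intros) auto
  qed (auto simp: susp_simps intro!: continuous_on_point continuous_intros)
qed

lemma norm_poles_sq:
  assumes "x \<in> {51..100}"
  shows "(norm (susp x 0 - susp x 7))\<^sup>2 = x"
  using assms by (simp add: susp_simps norm_point_diff)

lemma len_nonneg:
  assumes "j \<in> {1..6}"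
  shows "len_north j \<ge> 0" "len_south j \<ge> 0"
proof -
  have "(len_diff j)\<^sup>2 \<le> (len_sum j)\<^sup>2"
    using sum_sq_gt[OF assms] diff_sq_lt[OF assms] by (simp add: len_sum_sq[OF assms] len_diff_sq[OF assms])
  then have "\<bar>len_diff j\<bar> \<le> len_sum j"
    using len_sum_pos[OF assms] by (simp add: power2_le_iff_abs_le)
  then show "len_north j \<ge> 0" "len_south j \<ge> 0"
    by (auto simp: len_sum_def len_diff_def)
qed

lemma norm_pole_edges:
  assumes "j \<in> {1..6}" "x \<in> {51..100}"
  shows "norm (susp x 0 - susp x j) = len_north j" "norm (susp x j - susp x 7) = len_south j"
proof -
  have x: "x > 0" "(sqrt x)\<^sup>2 = x" using assms(2) by auto
  have c: "(cmod (planar j x))\<^sup>2 = (((len_sum j)\<^sup>2 - x) * (x - (len_diff j)\<^sup>2)) / (4 * x)"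
    using cmod_planar[OF assms] by (simp add: radial_def len_sum_sq[OF assms(1)] len_diff_sq[OF assms(1)])
  have a1: "(axial j x)\<^sup>2 = (x - len_sum j * len_diff j)\<^sup>2 / (4 * x)"
    using x by (simp add: axial_def power_divide power_mult_distrib)
  have "sqrt x = 2 * x / (2 * sqrt x)"
    using x by (simp add: real_div_sqrt)
  then have "sqrt x - axial j x = 2 * x / (2 * sqrt x) - axial j x" by (rule arg_cong)
  also have "\<dots> = (x + len_sum j * len_diff j) / (2 * sqrt x)"
    unfolding axial_def diff_divide_distrib[symmetric] by simp
  finally have a2: "(sqrt x - axial j x)\<^sup>2 = (x + len_sum j * len_diff j)\<^sup>2 / (4 * x)"
    using x(1) by (simp add: power_divide power_mult_distrib)
  \<comment> \<open>One identity serves both poles: A + B is twice the north length, and replacing B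
    by -B gives the south length.\<close>
  have s: "(A\<^sup>2 - x) * (x - B\<^sup>2) / (4 * x) + (x + A * B)\<^sup>2 / (4 * x) = ((A + B) / 2)\<^sup>2" for A B
  proof -
    have "(A\<^sup>2 - x) * (x - B\<^sup>2) + (x + A * B)\<^sup>2 = x * (A + B)\<^sup>2" by algebra
    then show ?thesis using x by (simp add: power_divide flip: add_divide_distrib)
  qed
  have "(norm (susp x 0 - susp x j))\<^sup>2 = ((len_sum j + len_diff j) / 2)\<^sup>2"
    unfolding susp_simps(1) susp_simps(3)[OF assms(1)] norm_point_diff a2
    by (simp add: c s)
  then show "norm (susp x 0 - susp x j) = len_north j"
    using len_nonneg[OF assms(1)] by - (rule power2_eq_imp_eq; simp add: len_sum_def len_diff_def)
  have "(norm (susp x j - susp x 7))\<^sup>2 = ((len_sum j - len_diff j) / 2)\<^sup>2"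
    unfolding susp_simps(2) susp_simps(3)[OF assms(1)] norm_point_diff
    using s[of "len_sum j" "- len_diff j"] by (simp add: c a1)
  then show "norm (susp x j - susp x 7) = len_south j"
    using len_nonneg[OF assms(1)] by - (rule power2_eq_imp_eq; simp add: len_sum_def len_diff_def)
qed

lemma len_equator_pos: "j \<in> {1..6} \<Longrightarrow> len_equator j > 0"
  by (erule vertex_cases) (simp_all add: data_defs)

lemma norm_equator_edges:
  assumes "j \<in> {1..6}" "x \<in> {51..100}"
  shows "norm (susp x j - susp x (eq_next 6 j)) = len_equator j"
proof -
  define k where "k = eq_next 6 j"
  have k: "k \<in> {1..6}" unfolding k_def by (rule eq_next_in[OF assms(1)])
  have x: "x > 0" "(sqrt x)\<^sup>2 = x" using assms(2) by auto
  have "(cmod (planar j x - planar k x))\<^sup>2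
      = (cmod (planar j x))\<^sup>2 + (cmod (planar k x))\<^sup>2 - 2 * Re (cnj (planar j x) * planar k x)"
    unfolding cmod_power2 by (simp add: algebra_simps power2_eq_square)
  also have "\<dots> = (radial j x + radial k x - 2 * Re (rot j x)) / (4 * x)"
    using cnj_planar_next[OF assms] unfolding k_def[symmetric] cmod_planar[OF assms] cmod_planar[OF k assms(2)]
    by (simp add: Re_divide_of_real add_divide_distrib diff_divide_distrib del: of_real_mult)
  finally have 1: "(cmod (planar j x - planar k x))\<^sup>2 = \<dots>" .
  have "axial j x - axial k x = (sq_diff_coeff k - sq_diff_coeff j) * sqrt 51 / (2 * sqrt x)"
    unfolding axial_def len_sum_diff[OF assms(1)] len_sum_diff[OF k]
    by (simp add: algebra_simps flip: diff_divide_distrib)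
  then have 2: "(axial j x - axial k x)\<^sup>2 = 51 * (sq_diff_coeff k - sq_diff_coeff j)\<^sup>2 / (4 * x)"
    using x by (simp add: power_divide power_mult_distrib)
  \<comment> \<open>The real part of \<open>rot\<close>, and with it \<open>rot_coeff\<close>, is
    this law of cosines solved for the mixed term.\<close>
  have "(norm (susp x j - susp x k))\<^sup>2 = (len_equator j)\<^sup>2"
    unfolding susp_simps(3)[OF assms(1)] susp_simps(3)[OF k] norm_point_diff 1 2
    unfolding radial_eq[OF assms(1)] radial_eq[OF k] rot_def k_def[symmetric] rot_coeff_def
    using x(1) by (simp add: field_simps power2_eq_square)
  then show ?thesis
    unfolding k_def using len_equator_pos[OF assms(1)] by - (rule power2_eq_imp_eq; simp)
qed

text \<open>At x = 51 and x = 100 the factor \<open>sqrt_gram x\<close> vanishes and all vertices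
  lie in one plane; strictly between, it is positive and the sign comes from
  \<open>face_sign\<close> alone.\<close>

lemma sgn_face:
  assumes "j \<in> {1..6}" "51 < x" "x < 100"
  shows "sgn (cross3 (susp x 0 - susp x j) (susp x 0 - susp x (eq_next 6 j)) \<bullet> (susp x 0 - susp x 7))
    = face_sign j"
proof -
  have x: "x \<in> {51..100}" using assms by simp
  have "face_sign j \<in> {-1, 1}" using face_sign_sq[OF assms(1)] by (simp add: power2_eq_1_iff disj_commute)
  moreover have "sqrt_gram x > 0" using assms by (simp add: sqrt_gram_def)
  moreover have "Im (rot j x / of_real (4 * x)) = face_sign j * (len_equator j * sqrt_gram x / (2 * x))"
    by (simp add: rot_def Im_divide_of_real del: of_real_mult)
  ultimately show ?thesis
    using len_equator_pos[OF assms(1)] assms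
    unfolding susp_simps(1,2) susp_simps(3)[OF assms(1)] susp_simps(3)[OF eq_next_in[OF assms(1)]]
      cross3_point cnj_planar_next[OF assms(1) x]
    by (auto simp: sgn_mult)
qed

section \<open>Flexibility\<close>

lemma isometric_susp:
  assumes "x \<in> {51..100}" "y \<in> {51..100}"
  shows "isometric_polyhedra (suspension_complex 6) (susp x) (susp y)"
  unfolding isometric_polyhedra_def
proof (intro allI impI)
  have pole: "dist (susp y i) (susp y j) = dist (susp x i) (susp x j)" if "i = 0 \<or> i = 7" "j \<in> {1..6}" for i j
    using that(1) norm_pole_edges[OF that(2) assms(1)] norm_pole_edges[OF that(2) assms(2)]
    by (auto simp: dist_norm norm_minus_commute)
  have equator: "dist (susp y j) (susp y (eq_next 6 j)) = dist (susp x j) (susp x (eq_next 6 j))"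
    if "j \<in> {1..6}" for j
    using norm_equator_edges[OF that] assms by (simp add: dist_norm)
  fix u v assume "{u, v} \<in> suspension_complex 6"
  then obtain i j where ij: "i = 0 \<or> i = 7" "j \<in> {1..6}" "{u, v} \<subseteq> {i, j, eq_next 6 j}"
    unfolding suspension_complex_def by fastforce
  note eqs = pole[OF ij(1,2)] pole[OF ij(1) eq_next_in[OF ij(2)]] equator[OF ij(2)]
  from ij(3) have "u \<in> {i, j, eq_next 6 j}" "v \<in> {i, j, eq_next 6 j}" by simp_all
  then show "dist (susp y u) (susp y v) = dist (susp x u) (susp x v)"
    by (elim insertE emptyE; simp add: eqs dist_commute)
qed

text \<open>The distance between the poles is invariant under congruence, and its square is the
  parameter.\<close>

lemma congruent_susp_imp_eq:
  assumes "x \<in> {51..100}" "y \<in> {51..100}" "congruent_polyhedra (suspension_complex 6) (susp x) (susp y)"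
  shows "x = y"
proof -
  from assms(3) obtain A :: "real^3 \<Rightarrow> real^3" where A: "\<forall>a b. dist (A a) (A b) = dist a b"
      and eq: "\<forall>v\<in>{0..7}. susp y v = A (susp x v)"
    unfolding congruent_polyhedra_def by (auto simp: vertices_suspension_complex)
  have "dist (susp y 0) (susp y 7) = dist (susp x 0) (susp x 7)"
    by (simp add: A eq)
  then show ?thesis using norm_poles_sq[OF assms(1)] norm_poles_sq[OF assms(2)] by (simp add: dist_norm)
qed

lemma flexible_susp:
  assumes "x \<in> {51..100}"
  shows "flexible (suspension_complex 6) (susp x)"
proof -
  \<comment> \<open>An endpoint of the interval different from x; the segment from x to y stays
    inside the parameter range.\<close>
  define y :: real where "y = (if x = 51 then 100 else 51)"
  have y: "y \<in> {51..100}" "y \<noteq> x" by (auto simp: y_def)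
  define path where "path t = (1 - t) * x + t * y" for t
  have path: "path t \<in> {51..100}" if "t \<in> {0..1}" for t
    using that assms y(1) convexD_alt[of "{51..100}" x y t] by (auto simp: path_def)
  have "continuous_on {0..1} (\<lambda>t. susp (path t) v)" if "v \<in> {0..7}" for v
    using path by (intro continuous_on_compose2[OF continuous_on_susp[OF that]])
      (auto simp: path_def intro!: continuous_intros)
  moreover have "path 0 = x" "path 1 = y" by (simp_all add: path_def)
  ultimately show ?thesis
    unfolding flexible_def
    using path isometric_susp[OF assms] congruent_susp_imp_eq[OF assms y(1)] y(2)
    by (intro exI[of _ "\<lambda>t. susp (path t)"]) (auto simp: vertices_suspension_complex intro!: bexI[of _ 1])
qed

section \<open>Non-triviality\<close>

definition eq_prev :: "nat \<Rightarrow> nat" where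
  "eq_prev k = (if k = 1 then 6 else k - 1)"

text \<open>The ends of the subdivided edge become the neighbours of the new vertex once the later
  labels are shifted, also across the wrap-around for k = 1 and k = 6.\<close>

lemma equator_insertion_5_imp_collinear:
  assumes "equator_insertion 5 r p"
  obtains k t where "k \<in> {1..6}" "0 < t" "t < 1"
    "p k = (1 - t) *\<^sub>R p (eq_prev k) + t *\<^sub>R p (eq_next 6 k)"
proof -
  from assms obtain k t where k: "k \<in> {1..6}"
      and eq: "\<And>j. j \<in> {1..<k} \<Longrightarrow> r j = p j" "\<And>j. j \<in> {k..5} \<Longrightarrow> r j = p (j + 1)"
      and t: "0 < t" "t < 1"
      and pk: "p k = (1 - t) *\<^sub>R r (if k = 1 then 5 else k - 1) + t *\<^sub>R r (if k = 6 then 1 else k)"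
    unfolding equator_insertion_def by auto
  have "r (if k = 1 then 5 else k - 1) = p (eq_prev k)"
    using k eq by (auto simp: eq_prev_def)
  moreover have "r (if k = 6 then 1 else k) = p (eq_next 6 k)"
    using k eq by (auto simp: eq_next_def)
  ultimately show thesis using that k t pk by simp
qed

text \<open>The quadratic terms in p cancel in the difference.\<close>

lemma dist_sq_diff_affine:
  fixes N S p q :: "'a::real_inner"
  defines "f \<equiv> \<lambda>p. (norm (N - p))\<^sup>2 - (norm (p - S))\<^sup>2"
  shows "f ((1 - t) *\<^sub>R p + t *\<^sub>R q) = (1 - t) * f p + t * f q"
proof -
  have "f p = (norm N)\<^sup>2 - (norm S)\<^sup>2 - 2 * ((N - S) \<bullet> p)" for p
    by (simp add: f_def power2_norm_eq_inner inner_diff inner_commute algebra_simps)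
  then show ?thesis by (simp only: inner_add_right inner_scaleR_right) (simp add: algebra_simps)
qed

text \<open>If p_k divided the segment between its neighbours, of length D, in the ratio t : (1 -
  t), its two equator edges would be t * D and (1 - t) * D. Eliminating t from the affine relation
  for \<open>sq_diff_coeff\<close> would give equality here.\<close>

lemma equator_coeff_not_straight:
  assumes "k \<in> {1..6}"
  shows "sq_diff_coeff k * (len_equator (eq_prev k) + len_equator k)
    \<noteq> len_equator k * sq_diff_coeff (eq_prev k) + len_equator (eq_prev k) * sq_diff_coeff (eq_next 6 k)"
  using assms by (rule vertex_cases) (simp_all add: data_defs eq_prev_def eq_next_def)

lemma not_trivial_by_insertion_susp:
  assumes "x \<in> {51..100}"
  shows "\<not> trivial_by_insertion (susp x)"
proof
  assume "trivial_by_insertion (susp x)"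
  then obtain r where "equator_insertion 5 r (susp x)"
    unfolding trivial_by_insertion_def by blast
  then obtain k t where k: "k \<in> {1..6}" and t: "0 < t" "t < 1"
    and eq: "susp x k = (1 - t) *\<^sub>R susp x (eq_prev k) + t *\<^sub>R susp x (eq_next 6 k)"
    by (rule equator_insertion_5_imp_collinear)
  have k': "eq_prev k \<in> {1..6}" "eq_next 6 (eq_prev k) = k" "eq_next 6 k \<in> {1..6}"
    using k by (auto simp: eq_prev_def eq_next_def)
  define D where "D = norm (susp x (eq_prev k) - susp x (eq_next 6 k))"
  have "susp x (eq_prev k) - susp x k = t *\<^sub>R (susp x (eq_prev k) - susp x (eq_next 6 k))"
       "susp x k - susp x (eq_next 6 k) = (1 - t) *\<^sub>R (susp x (eq_prev k) - susp x (eq_next 6 k))"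
    unfolding eq by (simp_all add: algebra_simps)
  then have l: "len_equator (eq_prev k) = t * D" "len_equator k = (1 - t) * D"
    using norm_equator_edges[OF k'(1) assms] norm_equator_edges[OF k assms] t by (simp_all add: k'(2) D_def)
  have f: "(norm (susp x 0 - susp x j))\<^sup>2 - (norm (susp x j - susp x 7))\<^sup>2 = sq_diff_coeff j * sqrt 51"
    if "j \<in> {1..6}" for j
    unfolding norm_pole_edges[OF that assms] len_sum_diff[OF that, symmetric]
    by (simp add: len_sum_def len_diff_def algebra_simps power2_eq_square)
  have "sq_diff_coeff k * sqrt 51
      = (1 - t) * (sq_diff_coeff (eq_prev k) * sqrt 51) + t * (sq_diff_coeff (eq_next 6 k) * sqrt 51)"
    using dist_sq_diff_affine[of "susp x 0" t "susp x (eq_prev k)" "susp x (eq_next 6 k)" "susp x 7"]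
    unfolding eq[symmetric] f[OF k] f[OF k'(1)] f[OF k'(3)] .
  then have "sqrt 51 * sq_diff_coeff k = sqrt 51 * ((1 - t) * sq_diff_coeff (eq_prev k) + t * sq_diff_coeff (eq_next 6 k))"
    by (simp add: algebra_simps)
  then have "sq_diff_coeff k = (1 - t) * sq_diff_coeff (eq_prev k) + t * sq_diff_coeff (eq_next 6 k)"
    by simp
  then have "sq_diff_coeff k * D = ((1 - t) * sq_diff_coeff (eq_prev k) + t * sq_diff_coeff (eq_next 6 k)) * D"
    by simp
  then show False using equator_coeff_not_straight[OF k] unfolding l by (simp add: algebra_simps)
qed

text \<open>Doubling makes the poles coincide, whereas |N - S|^2 = x is at least 51.\<close>

lemma not_trivial_by_doubling_susp:
  assumes "x \<in> {51..100}"
  shows "\<not> trivial_by_doubling (susp x)"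
  using norm_poles_sq[OF assms] assms unfolding trivial_by_doubling_def by force

theorem mainTheorem1:
  shows "\<exists>\<S> :: real \<Rightarrow> nat \<Rightarrow> real^3.
    (\<forall>v\<in>{0..7}. continuous_on {51..100} (\<lambda>x. \<S> x v)) \<and>
    (\<forall>x\<in>{51..100}.
       (norm (\<S> x 0 - \<S> x 7))\<^sup>2 = x \<and>
       (\<forall>j\<in>{1..6}.
          norm (\<S> x 0 - \<S> x j) = len_north j \<and>
          norm (\<S> x j - \<S> x 7) = len_south j \<and>
          norm (\<S> x j - \<S> x (eq_next 6 j)) = len_equator j) \<and>
       (51 < x \<and> x < 100 \<longrightarrow>
          (\<forall>j\<in>{1..6}.
             sgn (cross3 (\<S> x 0 - \<S> x j) (\<S> x 0 - \<S> x (eq_next 6 j)) \<bullet> (\<S> x 0 - \<S> x 7))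
               = face_sign j)) \<and>
       flexible (suspension_complex 6) (\<S> x) \<and>
       \<not> trivial_by_insertion (\<S> x) \<and>
       \<not> trivial_by_doubling (\<S> x))"
  using continuous_on_susp norm_poles_sq norm_pole_edges norm_equator_edges sgn_face flexible_susp
    not_trivial_by_insertion_susp not_trivial_by_doubling_susp
  by (intro exI[of _ susp] conjI ballI impI) (simp_all only: not_False_eq_True)

end
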